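(* Let $\mathbf{U}$ be a finite set of players. The MPW solution $\mathrm{MPW}$ is the unique solution $\varphi$ for TUX games (with player sets $N\subseteq\mathbf{U}$) that satisfies the following two properties. (Efficiency, EF$^{X}$) For all $N\subseteq\mathbf{U}$ and $w\in\mathbb{W}(N)$: $\sum_{i\in N}\varphi_i(w)=w(N,\emptyset)$. (Balanced contributions, BC$^{X}$) For all $N\subseteq\mathbf{U}$, $w\in\mathbb{W}(N)$, and $i,j\in N$: $\varphi_i(w)-\varphi_i(w_{-j})=\varphi_j(w)-\varphi_j(w_{-i})$ (for $i=j$ this is regarded as trivially satisfied).
   Context: Let $\mathbf{U}$ be a finite set (the universe of players). Cardinalities of sets $N,S,T,B\subseteq\mathbf{U}$ are denoted $n,s,t,b$. Partitions. For $N\subseteq\mathbf{U}$, $\Pi(N)$ is the set of partitions of $N$ into non-empty blocks, with $\Pi(\emptyset)=\{\emptyset\}$. For $\pi\in\Pi(N)$ and $i\in N$, $\pi(i)$ is the block containing $i$. For $\pi\in\Pi(N)$, $i\in\mathbf{U}\setminus N$, $B\in\pi$: $\pi_{+i\rightsquigarrow B}=(\pi\setminus\{B\})\cup\{B\cup\{i\}\}$ and $\pi_{+i\rightsquigarrow\emptyset}=\pi\cup\{\{i\}\}$. TUX games. $\mathcal{E}(N)=\{(S,\pi)\mid S\subseteq N,\ \pi\in\Pi(N\setminus S)\}$ is the set of embedded coalitions. A TUX game (game with externalities) for $N\subseteq\mathbf{U}$ is a function $w:\mathcal{E}(N)\to\mathbb{R}$ with $w(\emptyset,\pi)=0$ for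 all $\pi\in\Pi(N)$; $\mathbb{W}(N)$ is the set of these. A solution for TUX games is a map $\varphi$ assigning to each $w\in\mathbb{W}(N)$, $N\subseteq\mathbf{U}$, a vector $\varphi(w)\in\mathbb{R}^N$. Removal of a player. For $w\in\mathbb{W}(N)$ and $i\in N$, the game $w_{-i}\in\mathbb{W}(N\setminus\{i\})$ is defined by $$w_{-i}(S,\pi)=\frac{1}{n-s}\Big(w(S,\pi_{+i\rightsquigarrow\emptyset})+\sum_{j\in N\setminus(S\cup\{i\})}w(S,\pi_{+i\rightsquigarrow\pi(j)})\Big)\quad\text{for all }(S,\pi)\in\mathcal{E}(N\setminus\{i\}).$$ MPW solution. A TU game for $N$ is a function $v:2^N\to\mathbb{R}$ with $v(\emptyset)=0$; its Shapley value is $\mathrm{Sh}_i(v)=\sum_{S\subseteq N\setminus\{i\}}\frac{s!(n-s-1)!}{n!}\left(v(S\cup\{i\})-v(S)\right)$, $i\in N$. For $w\in\mathbb{W}(N)$, the average game $\bar v_w$ is the TU game for $N$ given by $$\bar v_w(S)=\sum_{\pi\in\Pi(N\setminus S)}\frac{\prod_{B\in\pi}(b-1)!}{(n-s)!}\,w(S,\pi)\quad\text{for all }S\subseteq N,$$ and $\mathrm{MPW}(w)=\mathrm{Sh}(\bar v_w)\in\mathbb{R}^N$. *)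

theory Defs
  imports Complex_Main "HOL-Library.FuncSet" "HOL-Library.Disjoint_Sets"
begin

text \<open>
  Functions with a prescribed domain (games on a player set, payoff vectors indexed by the players,
  solutions) are elements of the extensional function spaces \<^const>\<open>PiE\<close>, so that equality of such
  functions is equality of functions on their domain.
\<close>

definition partitions :: "'a set \<Rightarrow> 'a set set set" where
  "partitions N = {\<pi>. partition_on N \<pi>}"

definition block_of :: "'a set set \<Rightarrow> 'a \<Rightarrow> 'a set" where
  "block_of \<pi> i = (THE B. B \<in> \<pi> \<and> i \<in> B)"

definition add_to_block :: "'a set set \<Rightarrow> 'a \<Rightarrow> 'a set \<Rightarrow> 'a set set" where
  "add_to_block \<pi> i B = (\<pi> - {B}) \<union> {B \<union> {i}}"

definition add_singleton :: "'a set set \<Rightarrow> 'a \<Rightarrow> 'a set set" where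
  "add_singleton \<pi> i = \<pi> \<union> {{i}}"

subsection \<open>Games with externalities\<close>

definition embedded_coalitions :: "'a set \<Rightarrow> ('a set \<times> 'a set set) set" where
  "embedded_coalitions N = {(S, \<pi>). S \<subseteq> N \<and> \<pi> \<in> partitions (N - S)}"

type_synonym 'a tux_game = "'a set \<times> 'a set set \<Rightarrow> real"

definition tux_games :: "'a set \<Rightarrow> 'a tux_game set" where
  "tux_games N =
     {w \<in> embedded_coalitions N \<rightarrow>\<^sub>E UNIV. \<forall>\<pi>\<in>partitions N. w ({}, \<pi>) = 0}"

text \<open>
  A solution maps a player set and a game for it to a payoff vector. The player set is an
  explicit argument because it cannot be recovered from an extensional function.
\<close>

type_synonym 'a tux_solution = "'a set \<Rightarrow> 'a tux_game \<Rightarrow> 'a \<Rightarrow> real"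

definition tux_solutions :: "'a set \<Rightarrow> 'a tux_solution set" where
  "tux_solutions U = (\<Pi>\<^sub>E N\<in>Pow U. tux_games N \<rightarrow>\<^sub>E (N \<rightarrow>\<^sub>E UNIV))"

definition remove_player :: "'a set \<Rightarrow> 'a tux_game \<Rightarrow> 'a \<Rightarrow> 'a tux_game" where
  "remove_player N w i =
     (\<lambda>(S, \<pi>)\<in>embedded_coalitions (N - {i}).
        1 / (real (card N) - real (card S)) *
        (w (S, add_singleton \<pi> i) +
         (\<Sum>j\<in>N - (S \<union> {i}). w (S, add_to_block \<pi> i (block_of \<pi> j)))))"

subsection \<open>The MPW solution\<close>

definition tu_games :: "'a set \<Rightarrow> ('a set \<Rightarrow> real) set" where
  "tu_games N = {v \<in> Pow N \<rightarrow>\<^sub>E UNIV. v {} = 0}"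

definition shapley :: "'a set \<Rightarrow> ('a set \<Rightarrow> real) \<Rightarrow> 'a \<Rightarrow> real" where
  "shapley N v =
     (\<lambda>i\<in>N. \<Sum>S\<in>Pow (N - {i}).
        fact (card S) * fact (card N - card S - 1) / fact (card N) * (v (S \<union> {i}) - v S))"

definition average_game :: "'a set \<Rightarrow> 'a tux_game \<Rightarrow> 'a set \<Rightarrow> real" where
  "average_game N w =
     (\<lambda>S\<in>Pow N. \<Sum>\<pi>\<in>partitions (N - S).
        (\<Prod>B\<in>\<pi>. fact (card B - 1)) / fact (card N - card S) * w (S, \<pi>))"

definition MPW :: "'a set \<Rightarrow> 'a tux_solution" where
  "MPW U = (\<lambda>N\<in>Pow U. \<lambda>w\<in>tux_games N. shapley N (average_game N w))"

subsection \<open>Properties of solutions\<close>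

definition efficient :: "'a set \<Rightarrow> 'a tux_solution \<Rightarrow> bool" where
  "efficient U \<phi> \<longleftrightarrow>
     (\<forall>N w. N \<subseteq> U \<longrightarrow> w \<in> tux_games N \<longrightarrow> (\<Sum>i\<in>N. \<phi> N w i) = w (N, {}))"

text \<open>For \<open>i = j\<close> both sides of the equation below are the same term.\<close>

definition balanced_contributions :: "'a set \<Rightarrow> 'a tux_solution \<Rightarrow> bool" where
  "balanced_contributions U \<phi> \<longleftrightarrow>
     (\<forall>N w i j. N \<subseteq> U \<longrightarrow> w \<in> tux_games N \<longrightarrow> i \<in> N \<longrightarrow> j \<in> N \<longrightarrow>
        \<phi> N w i - \<phi> (N - {j}) (remove_player N w j) i =
        \<phi> N w j - \<phi> (N - {i}) (remove_player N w i) j)"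

subsection \<open>Well-definedness\<close>

lemma partitions_empty: "partitions {} = {{}}"
  by (auto simp: partitions_def partition_on_def)

lemma block_of_partition:
  assumes "\<pi> \<in> partitions N" "i \<in> N"
  shows "block_of \<pi> i \<in> \<pi>" and "i \<in> block_of \<pi> i"
proof -
  have "\<exists>!B. B \<in> \<pi> \<and> i \<in> B"
    using assms unfolding partitions_def partition_on_def disjoint_def by blast
  from theI'[OF this] show "block_of \<pi> i \<in> \<pi>" "i \<in> block_of \<pi> i"
    by (auto simp: block_of_def)
qed

lemma add_singleton_partition:
  assumes "\<pi> \<in> partitions N" "i \<notin> N"
  shows "add_singleton \<pi> i \<in> partitions (insert i N)"
  using assms unfolding partitions_def partition_on_def add_singleton_def disjoint_def by auto

lemma add_to_block_partition:
  assumes "\<pi> \<in> partitions N" "i \<notin> N" "B \<in> \<pi>"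
  shows "add_to_block \<pi> i B \<in> partitions (insert i N)"
  using assms unfolding partitions_def partition_on_def add_to_block_def disjoint_def by auto

lemma remove_player_tux_game:
  assumes w: "w \<in> tux_games N" and i: "i \<in> N"
  shows "remove_player N w i \<in> tux_games (N - {i})"
proof -
  have ins: "insert i N = N" using i by auto
  have "remove_player N w i ({}, \<pi>) = 0" if p: "\<pi> \<in> partitions (N - {i})" for \<pi>
  proof -
    have "w ({}, add_singleton \<pi> i) = 0"
      using add_singleton_partition[OF p, of i] w by (simp add: ins tux_games_def)
    moreover have "w ({}, add_to_block \<pi> i (block_of \<pi> j)) = 0" if "j \<in> N - {i}" for j
      using add_to_block_partition[OF p, of i] block_of_partition(1)[OF p that] w
      by (simp add: ins tux_games_def)
    ultimately show ?thesis
      using p by (simp add: remove_player_def embedded_coalitions_def)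
  qed
  then show ?thesis
    by (auto simp: tux_games_def remove_player_def)
qed

lemma average_game_tu_game:
  assumes "w \<in> tux_games N"
  shows "average_game N w \<in> tu_games N"
  using assms by (auto simp: tu_games_def average_game_def tux_games_def)

lemma MPW_tux_solution: "MPW U \<in> tux_solutions U"
  by (auto simp: MPW_def tux_solutions_def shapley_def)

end

theory Submission
  imports Defs
begin

text \<open>
  Averaging commutes with the removal of a player: the average game of \<open>w\<^sub>-\<^sub>i\<close> is the restriction of
  the average game of \<open>w\<close>, because the weight \<open>\<Prod>B\<in>\<pi>. (b - 1)!\<close> gets multiplied by \<open>b\<close> when \<open>i\<close>
  joins the block \<open>B\<close>, and exactly \<open>b\<close> players \<open>j\<close> have \<open>\<pi>(j) = B\<close>. Hence MPW inherits efficiency and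
  balanced contributions from the Shapley value. Conversely, by induction on the player set, balanced
  contributions make the payoff difference of two solutions the same for all players, and efficiency
  makes these differences sum to zero.
\<close>

section \<open>Partitions\<close>

lemma finite_partitions:
  assumes "finite N"
  shows "finite (partitions N)"
  unfolding partitions_def using finitely_many_partition_on[OF assms] by simp

lemma finite_partition:
  assumes "finite N" "\<pi> \<in> partitions N"
  shows "finite \<pi>"
  using assms finite_elements unfolding partitions_def by blast

lemma block_of_eq:
  assumes "\<pi> \<in> partitions N" "B \<in> \<pi>" "i \<in> B"
  shows "block_of \<pi> i = B"
proof -
  have "i \<in> N" using assms unfolding partitions_def partition_on_def by auto
  from block_of_partition[OF assms(1) this] show ?thesis
    using assms unfolding partitions_def partition_on_def disjoint_def by blast
qed

text \<open>Since \<open>{}\<close> is never a block, founding a new block amounts to joining the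
  empty one. The ways to add a player to \<open>\<pi>\<close> are thereby indexed uniformly by
  \<open>insert {} \<pi>\<close>.\<close>

lemma add_singleton_conv:
  assumes "\<pi> \<in> partitions N"
  shows "add_singleton \<pi> i = add_to_block \<pi> i {}"
  using assms unfolding partitions_def partition_on_def add_singleton_def add_to_block_def by auto

section \<open>Adding a player to a partition and taking it out again\<close>

lemma partitions_extend:
  assumes "\<pi> \<in> partitions N" "i \<notin> N" "C \<in> insert {} \<pi>"
  shows "add_to_block \<pi> i C \<in> partitions (insert i N)"
proof (cases "C = {}")
  case True
  then show ?thesis
    using add_singleton_partition[OF assms(1,2)] by (simp add: add_singleton_conv[OF assms(1)])
next
  case False
  then show ?thesis using add_to_block_partition[OF assms(1,2)] assms(3) by blast
qed

text \<open>Taking \<open>i\<close> out of its block keeps blocks disjoint. The final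
  \<open>- {{}}\<close> discards the remainder in case \<open>i\<close> formed a block of its
  own.\<close>

lemma partitions_remove:
  assumes "\<rho> \<in> partitions (insert i N)" "i \<notin> N"
  shows "insert (block_of \<rho> i - {i}) (\<rho> - {block_of \<rho> i}) - {{}} \<in> partitions N"
proof -
  define D where "D = block_of \<rho> i"
  have D: "D \<in> \<rho>" "i \<in> D"
    using block_of_partition[OF assms(1)] by (auto simp: D_def)
  have un: "\<Union>\<rho> = insert i N"
    and dis: "\<And>B C. B \<in> \<rho> \<Longrightarrow> C \<in> \<rho> \<Longrightarrow> B \<noteq> C \<Longrightarrow> B \<inter> C = {}"
    using assms(1) unfolding partitions_def partition_on_def disjoint_def by auto
  have "\<Union>(insert (D - {i}) (\<rho> - {D}) - {{}}) = D - {i} \<union> \<Union>(\<rho> - {D})"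
    by auto
  \<comment> \<open>By disjointness \<open>D\<close> is the only block containing
    \<open>i\<close>.\<close>
  also have "\<dots> = \<Union>\<rho> - {i}"
    using D dis by blast
  also have "\<dots> = N"
    using un assms(2) by auto
  finally have "\<Union>(insert (D - {i}) (\<rho> - {D}) - {{}}) = N" .
  moreover have "disjoint (insert (D - {i}) (\<rho> - {D}) - {{}})"
  proof (rule disjointI)
    fix B C
    assume BC: "B \<in> insert (D - {i}) (\<rho> - {D}) - {{}}"
      "C \<in> insert (D - {i}) (\<rho> - {D}) - {{}}" "B \<noteq> C"
    have rest: "E \<inter> D = {}" if "E \<in> \<rho> - {D}" for E
      using dis[of E D] D(1) that by simp
    consider "B \<in> \<rho>" "C \<in> \<rho>" | "B = D - {i}" "C \<in> \<rho> - {D}" | "B \<in> \<rho> - {D}" "C = D - {i}"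
      using BC by blast
    then show "B \<inter> C = {}"
    proof cases
      case 1
      then show ?thesis using dis BC(3) by simp
    next
      case 2
      then show ?thesis using rest[of C] by blast
    next
      case 3
      then show ?thesis using rest[of B] by blast
    qed
  qed
  ultimately show ?thesis
    by (simp add: partitions_def partition_on_def D_def)
qed

text \<open>A partition of \<open>insert i N\<close> corresponds bijectively to a pair of a
  partition of \<open>N\<close> and the possibly empty set \<open>C\<close> of companions of
  \<open>i\<close>. The inverse map deletes \<open>i\<close> and records what is left of its
  block.\<close>

lemma sum_partitions_insert:
  fixes f :: "'a set set \<Rightarrow> 'b::comm_monoid_add"
  assumes "finite N" "i \<notin> N"
  shows "(\<Sum>\<rho>\<in>partitions (insert i N). f \<rho>) =
    (\<Sum>\<pi>\<in>partitions N. \<Sum>C\<in>insert {} \<pi>. f (add_to_block \<pi> i C))"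
proof -
  let ?r = "\<lambda>\<rho>. insert (block_of \<rho> i - {i}) (\<rho> - {block_of \<rho> i}) - {{}}"
  have "(\<Sum>\<pi>\<in>partitions N. \<Sum>C\<in>insert {} \<pi>. f (add_to_block \<pi> i C)) =
     (\<Sum>(\<pi>, C)\<in>(SIGMA \<pi>:partitions N. insert {} \<pi>). f (add_to_block \<pi> i C))"
    using finite_partitions[OF assms(1)] finite_partition[OF assms(1)] by (subst sum.Sigma) auto
  also have "\<dots> = (\<Sum>\<rho>\<in>partitions (insert i N). f \<rho>)"
  proof (rule sum.reindex_bij_witness
      [where j = "\<lambda>(\<pi>, C). add_to_block \<pi> i C" and i = "\<lambda>\<rho>. (?r \<rho>, block_of \<rho> i - {i})"])
    fix \<rho> assume \<rho>: "\<rho> \<in> partitions (insert i N)"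
    have D: "block_of \<rho> i \<in> \<rho>" "i \<in> block_of \<rho> i"
      using block_of_partition[OF \<rho>] by auto
    show "(case (?r \<rho>, block_of \<rho> i - {i}) of (\<pi>, C) \<Rightarrow> add_to_block \<pi> i C) = \<rho>"
    proof -
      have "\<And>B. B \<in> \<rho> \<Longrightarrow> B \<noteq> {}"
        and dis: "\<And>B C. B \<in> \<rho> \<Longrightarrow> C \<in> \<rho> \<Longrightarrow> B \<noteq> C \<Longrightarrow> B \<inter> C = {}"
        using \<rho> unfolding partitions_def partition_on_def disjoint_def by auto
      \<comment> \<open>\<open>add_to_block\<close> first removes the set that \<open>i\<close>
        joins. This must not remove an original block of \<open>\<rho>\<close>, and it does not: a
        block equal to the remainder would be a nonempty proper subset of the block of
        \<open>i\<close>.\<close>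
      moreover have "B \<noteq> block_of \<rho> i - {i}" if "B \<in> \<rho>" for B
        using dis[OF that D(1)] D that calculation(1) by blast
      moreover have "block_of \<rho> i - {i} \<union> {i} = block_of \<rho> i" using D by auto
      ultimately show ?thesis
        using D unfolding add_to_block_def by auto
    qed
    show "(?r \<rho>, block_of \<rho> i - {i}) \<in> (SIGMA \<pi>:partitions N. insert {} \<pi>)"
      using partitions_remove[OF \<rho> assms(2)] by auto
  next
    fix p assume p: "p \<in> (SIGMA \<pi>:partitions N. insert {} \<pi>)"
    obtain \<pi> C where [simp]: "p = (\<pi>, C)" by fastforce
    have \<pi>: "\<pi> \<in> partitions N" and C: "C \<in> insert {} \<pi>" using p by auto
    have part: "add_to_block \<pi> i C \<in> partitions (insert i N)"
      by (rule partitions_extend[OF \<pi> assms(2) C])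
    have blk: "block_of (add_to_block \<pi> i C) i = insert i C"
      by (rule block_of_eq[OF part]) (auto simp: add_to_block_def)
    have notin: "\<And>B. B \<in> insert {} \<pi> \<Longrightarrow> i \<notin> B" and ne: "{} \<notin> \<pi>"
      using \<pi> assms(2) unfolding partitions_def partition_on_def by auto
    show "(case p of (\<pi>, C) \<Rightarrow> add_to_block \<pi> i C) \<in> partitions (insert i N)"
      using part by simp
    have "insert i C - {i} = C" using notin[OF C] by auto
    moreover have "?r (add_to_block \<pi> i C) = \<pi>"
    proof -
      \<comment> \<open>The enlarged block is really new, so removing it loses no block of
        \<open>\<pi>\<close>.\<close>
      have "insert i C \<notin> \<pi>" using notin by auto
      then have "add_to_block \<pi> i C - {insert i C} = \<pi> - {C}"
        by (auto simp: add_to_block_def)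
      then show ?thesis using ne C unfolding blk \<open>insert i C - {i} = C\<close> by auto
    qed
    ultimately show "(?r (case p of (\<pi>, C) \<Rightarrow> add_to_block \<pi> i C),
        block_of (case p of (\<pi>, C) \<Rightarrow> add_to_block \<pi> i C) i - {i}) = p"
      using blk by simp
    show "f (case p of (\<pi>, C) \<Rightarrow> add_to_block \<pi> i C) =
        (case p of (\<pi>, C) \<Rightarrow> f (add_to_block \<pi> i C))" by simp
  qed
  finally show ?thesis by simp
qed

section \<open>Counting blocks by players, and the weights of extended partitions\<close>

lemma sum_block_of:
  fixes g :: "'a set \<Rightarrow> real"
  assumes "finite N" "\<pi> \<in> partitions N"
  shows "(\<Sum>j\<in>N. g (block_of \<pi> j)) = (\<Sum>B\<in>\<pi>. real (card B) * g B)"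
proof -
  have un: "N = \<Union>\<pi>" and dis: "\<And>B C. B \<in> \<pi> \<Longrightarrow> C \<in> \<pi> \<Longrightarrow> B \<noteq> C \<Longrightarrow> B \<inter> C = {}"
    using assms(2) unfolding partitions_def partition_on_def disjoint_def by auto
  have "(\<Sum>j\<in>\<Union>\<pi>. g (block_of \<pi> j)) = (\<Sum>B\<in>\<pi>. \<Sum>j\<in>B. g (block_of \<pi> j))"
    using dis finite_subset[OF _ assms(1)] un by (subst sum.Union_disjoint) (auto simp: Sup_upper)
  also have "\<dots> = (\<Sum>B\<in>\<pi>. \<Sum>j\<in>B. g B)"
    using block_of_eq[OF assms(2)] by (intro sum.cong) auto
  finally show ?thesis using un by simp
qed

lemma prod_add_to_block:
  assumes "finite N" "\<pi> \<in> partitions N" "i \<notin> N" "B \<in> \<pi>"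
  shows "(\<Prod>C\<in>add_to_block \<pi> i B. fact (card C - 1) :: real) =
    real (card B) * (\<Prod>C\<in>\<pi>. fact (card C - 1))"
proof -
  have fin: "finite \<pi>" "finite B" and B: "B \<noteq> {}" "i \<notin> B" and notin: "B \<union> {i} \<notin> \<pi>"
    using assms finite_partition[OF assms(1,2)] finite_subset[OF _ assms(1), of B]
    unfolding partitions_def partition_on_def by auto
  \<comment> \<open>Nonemptiness makes the truncated \<open>card B - 1\<close> a true predecessor.
    The factor of the enlarged block is then b! = b (b - 1)!.\<close>
  then have "card B > 0" by (simp add: card_gt_0_iff)
  then have "(fact (card B) :: real) = real (card B) * fact (card B - 1)"
    by (rule fact_reduce)
  then show ?thesis
    using fin B notin assms(4) prod.remove[OF fin(1) assms(4), of "\<lambda>C. fact (card C - 1) :: real"]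
    by (simp add: add_to_block_def)
qed

lemma prod_add_singleton:
  assumes "finite N" "\<pi> \<in> partitions N" "i \<notin> N"
  shows "(\<Prod>C\<in>add_singleton \<pi> i. fact (card C - 1) :: real) = (\<Prod>C\<in>\<pi>. fact (card C - 1))"
proof -
  have "finite \<pi>" "{i} \<notin> \<pi>"
    using assms finite_partition[OF assms(1,2)] unfolding partitions_def partition_on_def by auto
  then show ?thesis by (simp add: add_singleton_def)
qed

section \<open>The average game\<close>

text \<open>The factor 1/(n - s) in \<open>remove_player\<close> turns the normalization (n - 1 -
  s)! of the smaller player set into the (n - s)! of the larger one.\<close>

lemma average_game_remove_player:
  assumes fin: "finite N" and i: "i \<in> N" and S: "S \<subseteq> N - {i}"
  shows "average_game (N - {i}) (remove_player N w i) S = average_game N w S"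
proof -
  let ?M = "N - {i} - S"
  let ?p = "\<lambda>\<pi>::'a set set. \<Prod>B\<in>\<pi>. fact (card B - 1) :: real"
  have M: "finite ?M" "i \<notin> ?M" "insert i ?M = N - S" using assms by auto
  have "card S \<le> card (N - {i})" using S fin by (intro card_mono) auto
  then have "card S < card N" using i fin by (metis card_Diff1_less order.strict_trans1)
  \<comment> \<open>\<open>m\<close> counts the players other than \<open>i\<close> outside
    \<open>S\<close>. The normalizations are thus \<open>fact (Suc m)\<close> before and
    \<open>fact m\<close> after the removal, with no truncated subtraction left.\<close>
  then obtain m where m: "card N = Suc m + card S" by (metis add.commute less_iff_Suc_add add_Suc)
  have "average_game N w S = (\<Sum>\<rho>\<in>partitions (insert i ?M). ?p \<rho> / fact (Suc m) * w (S, \<rho>))"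
    using S M(3) m by (auto simp: average_game_def)
  also have "\<dots> = (\<Sum>\<pi>\<in>partitions ?M. \<Sum>C\<in>insert {} \<pi>.
      ?p (add_to_block \<pi> i C) / fact (Suc m) * w (S, add_to_block \<pi> i C))"
    by (rule sum_partitions_insert[OF M(1,2)])
  also have "\<dots> = (\<Sum>\<pi>\<in>partitions ?M. ?p \<pi> / fact m * remove_player N w i (S, \<pi>))"
  proof (rule sum.cong[OF refl])
    fix \<pi> assume \<pi>: "\<pi> \<in> partitions ?M"
    have "finite \<pi>" "{} \<notin> \<pi>"
      using finite_partition[OF M(1) \<pi>] \<pi> by (auto simp: partitions_def partition_on_def)
    \<comment> \<open>The term \<open>C = {}\<close> splits off because \<open>{}\<close> is not a
      block of \<open>\<pi>\<close>. It is the case where \<open>i\<close> stays alone, with factor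
      0! = 1.\<close>
    then have "(\<Sum>C\<in>insert {} \<pi>.
        ?p (add_to_block \<pi> i C) / fact (Suc m) * w (S, add_to_block \<pi> i C)) =
      ?p \<pi> / fact (Suc m) * w (S, add_singleton \<pi> i) +
      (\<Sum>B\<in>\<pi>. (card B * ?p \<pi>) / fact (Suc m) * w (S, add_to_block \<pi> i B))"
      using prod_add_to_block[OF M(1) \<pi> M(2)] prod_add_singleton[OF M(1) \<pi> M(2)]
      by (simp add: add_singleton_conv[OF \<pi>])
    also have "\<dots> = ?p \<pi> / fact (Suc m) * (w (S, add_singleton \<pi> i) +
        (\<Sum>B\<in>\<pi>. card B * w (S, add_to_block \<pi> i B)))"
      by (simp add: distrib_left sum_distrib_left mult_ac del: fact_Suc)
    also have "(\<Sum>B\<in>\<pi>. card B * w (S, add_to_block \<pi> i B)) =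
        (\<Sum>j\<in>?M. w (S, add_to_block \<pi> i (block_of \<pi> j)))"
      by (rule sum_block_of[OF M(1) \<pi>, symmetric])
    also have "?M = N - (S \<union> {i})" by auto
    also have "?p \<pi> / fact (Suc m) * (w (S, add_singleton \<pi> i) +
        (\<Sum>j\<in>N - (S \<union> {i}). w (S, add_to_block \<pi> i (block_of \<pi> j)))) =
      ?p \<pi> / fact m * remove_player N w i (S, \<pi>)"
      using \<pi> S m by (simp add: remove_player_def embedded_coalitions_def)
    finally show "(\<Sum>C\<in>insert {} \<pi>.
        ?p (add_to_block \<pi> i C) / fact (Suc m) * w (S, add_to_block \<pi> i C)) =
      ?p \<pi> / fact m * remove_player N w i (S, \<pi>)" .
  qed
  also have "\<dots> = average_game (N - {i}) (remove_player N w i) S"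
    using S m i fin by (simp add: average_game_def)
  finally show ?thesis by simp
qed

lemma average_game_grand:
  "average_game N w N = w (N, {})"
  by (simp add: average_game_def partitions_empty)

lemma average_game_empty:
  assumes "w \<in> tux_games N"
  shows "average_game N w {} = 0"
  using average_game_tu_game[OF assms] by (simp add: tu_games_def)

section \<open>The Shapley value\<close>

lemma shapley_cong:
  assumes "\<And>S. S \<subseteq> N \<Longrightarrow> v S = v' S"
  shows "shapley N v = shapley N v'"
proof -
  have "v (S \<union> {i}) = v' (S \<union> {i}) \<and> v S = v' S" if "i \<in> N" "S \<in> Pow (N - {i})" for i S
    using that by (intro conjI assms) auto
  then show ?thesis
    unfolding shapley_def by (intro restrict_ext sum.cong) simp_all
qed

text \<open>Collect the coefficient of each \<open>v T\<close>. With t the size of \<open>T\<close>,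
  its t members contribute t p(t - 1) = q(t), and the n - t outsiders contribute -(n - t) p(t) =
  -q(t). These cancel unless \<open>T\<close> has no members or no outsiders, which leaves
  \<open>v N\<close> and \<open>v {}\<close>.\<close>

lemma shapley_efficient:
  assumes fin: "finite N"
  shows "(\<Sum>i\<in>N. shapley N v i) = v N - v {}"
proof -
  let ?n = "card N"
  define p :: "nat \<Rightarrow> real" where "p s = fact s * fact (?n - s - 1) / fact ?n" for s
  \<comment> \<open>For s \<le> n this is the reciprocal of the binomial coefficient n over s, so it
    equals 1 at both 0 and n.\<close>
  define q :: "nat \<Rightarrow> real" where "q s = fact s * fact (?n - s) / fact ?n" for s
  have finP: "finite (Pow N)" using fin by simp
  have "(\<Sum>i\<in>N. shapley N v i) =
      (\<Sum>i\<in>N. \<Sum>S\<in>Pow (N - {i}). p (card S) * v (insert i S)) -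
      (\<Sum>i\<in>N. \<Sum>S\<in>Pow (N - {i}). p (card S) * v S)"
    by (simp add: shapley_def p_def right_diff_distrib sum_subtractf)
  \<comment> \<open>Reindex by the coalition \<open>T = insert i S\<close> after \<open>i\<close>
    has joined. The size at which the weight is taken is then \<open>card T - 1\<close>.\<close>
  also have "(\<Sum>i\<in>N. \<Sum>S\<in>Pow (N - {i}). p (card S) * v (insert i S)) =
      (\<Sum>i\<in>N. \<Sum>T | T \<in> Pow N \<and> i \<in> T. p (card T - 1) * v T)"
  proof (rule sum.cong[OF refl])
    fix i assume i: "i \<in> N"
    show "(\<Sum>S\<in>Pow (N - {i}). p (card S) * v (insert i S)) =
        (\<Sum>T | T \<in> Pow N \<and> i \<in> T. p (card T - 1) * v T)"
      using i by (intro sum.reindex_bij_witness[where i = "\<lambda>T. T - {i}" and j = "insert i"])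
        (auto simp: card_insert_if finite_subset[OF _ fin] subset_Diff_insert insert_absorb)
  qed
  also have "\<dots> = (\<Sum>T\<in>Pow N. \<Sum>i | i \<in> N \<and> i \<in> T. p (card T - 1) * v T)"
    by (rule sum.swap_restrict[OF fin finP])
  \<comment> \<open>The empty coalition must be left out: its inner sum is empty, while
    \<open>q 0\<close> is 1. The same happens below for \<open>N\<close>, which has no
    outsiders.\<close>
  also have "\<dots> = (\<Sum>T\<in>Pow N - {{}}. q (card T) * v T)"
  proof (rule sum.mono_neutral_cong_right[OF finP])
    fix T assume "T \<in> Pow N - {{}}"
    then have T: "T \<subseteq> N" "T \<noteq> {}" "finite T" using finite_subset[OF _ fin] by auto
    then obtain t where t: "card T = Suc t" by (cases "card T") auto
    have "{i. i \<in> N \<and> i \<in> T} = T" using T by auto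
    then show "(\<Sum>i | i \<in> N \<and> i \<in> T. p (card T - 1) * v T) = q (card T) * v T"
      using t by (simp add: p_def q_def)
  qed auto
  also have "\<dots> = (\<Sum>T\<in>Pow N. q (card T) * v T) - v {}"
    using sum.remove[OF finP, of "{}" "\<lambda>T. q (card T) * v T"] by (simp add: q_def)
  also have "(\<Sum>i\<in>N. \<Sum>S\<in>Pow (N - {i}). p (card S) * v S) =
      (\<Sum>i\<in>N. \<Sum>S | S \<in> Pow N \<and> i \<notin> S. p (card S) * v S)"
    by (intro sum.cong) auto
  also have "\<dots> = (\<Sum>S\<in>Pow N. \<Sum>i | i \<in> N \<and> i \<notin> S. p (card S) * v S)"
    by (rule sum.swap_restrict[OF fin finP])
  also have "\<dots> = (\<Sum>S\<in>Pow N - {N}. q (card S) * v S)"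
  proof (rule sum.mono_neutral_cong_right[OF finP])
    fix S assume "S \<in> Pow N - {N}"
    then have S: "S \<subset> N" by auto
    then have "card S < ?n" using psubset_card_mono fin by blast
    then obtain k where k: "?n - card S = Suc k" by (metis Suc_diff_Suc)
    have "{i. i \<in> N \<and> i \<notin> S} = N - S" by auto
    moreover have "card (N - S) = Suc k"
      using S k finite_subset[OF _ fin, of S] by (subst card_Diff_subset) auto
    ultimately show "(\<Sum>i | i \<in> N \<and> i \<notin> S. p (card S) * v S) = q (card S) * v S"
      using k by (simp add: p_def q_def)
  next
    show "\<forall>S\<in>Pow N - (Pow N - {N}). (\<Sum>i | i \<in> N \<and> i \<notin> S. p (card S) * v S) = 0"
    proof
      fix S assume "S \<in> Pow N - (Pow N - {N})"
      then have "{i. i \<in> N \<and> i \<notin> S} = {}" by auto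
      then show "(\<Sum>i | i \<in> N \<and> i \<notin> S. p (card S) * v S) = 0" by (simp only: sum.empty)
    qed
  qed auto
  also have "\<dots> = (\<Sum>T\<in>Pow N. q (card T) * v T) - v N"
    using sum.remove[OF finP, of N "\<lambda>T. q (card T) * v T"] by (simp add: q_def)
  finally show ?thesis by simp
qed

section \<open>Balanced contributions of the Shapley value\<close>

lemma sum_Pow_insert:
  fixes f :: "'a set \<Rightarrow> 'b::comm_monoid_add"
  assumes "finite M" "j \<notin> M"
  shows "(\<Sum>S\<in>Pow (insert j M). f S) = (\<Sum>T\<in>Pow M. f T + f (insert j T))"
proof -
  have "inj_on (insert j) (Pow M)"
    using assms by (auto simp: inj_on_def)
  moreover have "Pow M \<inter> insert j ` Pow M = {}" using assms by auto
  ultimately show ?thesis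
    using assms by (simp add: Pow_insert sum.union_disjoint sum.reindex sum.distrib)
qed

text \<open>The right-hand side is a weighted sum of second-order differences of \<open>v\<close>,
  hence symmetric in \<open>i\<close> and \<open>j\<close>; this symmetry is what yields balanced
  contributions. The same \<open>v\<close> serves both player sets because \<open>shapley\<close>
  evaluates it only on their subsets.\<close>

lemma shapley_contribution:
  assumes fin: "finite N" and ij: "i \<in> N" "j \<in> N" "i \<noteq> j"
  shows "shapley N v i - shapley (N - {j}) v i =
    (\<Sum>T\<in>Pow (N - {i, j}). fact (card T + 1) * fact (card N - card T - 2) / fact (card N) *
      (v (insert i (insert j T)) - v (insert i T) - v (insert j T) + v T))"
proof -
  let ?M = "N - {i, j}"
  have M: "finite ?M" "j \<notin> ?M" "N - {i} = insert j ?M" "N - {j} - {i} = ?M" using fin ij by auto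
  have cN: "card N = Suc (Suc (card ?M))"
  proof -
    have "card (N - {i, j}) = card N - 2" "card {i, j} \<le> card N"
      using card_Diff_subset[of "{i,j}" N] card_mono[of N "{i,j}"] fin ij by auto
    then show ?thesis using ij by simp
  qed
  have cNj: "card (N - {j}) = Suc (card ?M)" using cN ij fin by simp
  \<comment> \<open>The coalitions in \<open>N - {i}\<close> are paired as \<open>T\<close> and
    \<open>insert j T\<close>, so all sums run over the same index set.\<close>
  have "shapley N v i - shapley (N - {j}) v i = (\<Sum>T\<in>Pow ?M.
      fact (card T) * fact (card N - card T - 1) / fact (card N) * (v (insert i T) - v T) +
      fact (card (insert j T)) * fact (card N - card (insert j T) - 1) / fact (card N) *
        (v (insert i (insert j T)) - v (insert j T)) -
      fact (card T) * fact (card (N - {j}) - card T - 1) / fact (card (N - {j})) *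
        (v (insert i T) - v T))"
    unfolding shapley_def using ij M
    by (simp add: sum_Pow_insert[OF M(1,2)] sum_subtractf)
  also have "\<dots> = (\<Sum>T\<in>Pow ?M. fact (card T + 1) * fact (card N - card T - 2) / fact (card N) *
      (v (insert i (insert j T)) - v (insert i T) - v (insert j T) + v T))"
  proof (rule sum.cong[OF refl])
    fix T assume "T \<in> Pow ?M"
    then have T: "T \<subseteq> ?M" "finite T" "j \<notin> T" using finite_subset[OF _ M(1)] by auto
    have "card T \<le> card ?M" using T M by (intro card_mono)
    then obtain k where k: "card ?M = card T + k" using le_Suc_ex by blast
    define t where "t = card T"
    have n: "card N = Suc (Suc (t + k))" "card (N - {j}) = Suc (t + k)" "card (insert j T) = Suc t"
      using cN cNj k T by (auto simp: t_def)
    have e: "Suc (Suc (t + k)) - t - 1 = Suc k" "Suc (Suc (t + k)) - Suc t - 1 = k"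
      "Suc (t + k) - t - 1 = k" "Suc (Suc (t + k)) - t - 2 = k" by auto
    \<comment> \<open>\<open>F\<close> is (n - 1)!, where n = t + k + 2. Keeping it opaque gives n!
      = n F as a common denominator.\<close>
    define F where "F = (fact (Suc (t + k)) :: real)"
    have F: "fact (Suc (Suc (t + k))) = (real (t + k) + 2) * F"
      unfolding F_def fact_Suc[of "Suc (t + k)"] by simp
    have pos: "real (t + k) + 2 > 0" by simp
    \<comment> \<open>\<open>a\<close> and \<open>b\<close> are the marginal contributions of
      \<open>i\<close> without and with \<open>j\<close>. Over the common denominator,
      \<open>a\<close> has the coefficient t! k! ((k + 1) - (t + k + 2)) = -(t + 1)! k!, the
      negative of that of \<open>b\<close>.\<close>
    have "fact t * fact (Suc k) / ((real (t + k) + 2) * F) * a +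
        fact (Suc t) * fact k / ((real (t + k) + 2) * F) * b - fact t * fact k / F * a =
        fact (t + 1) * fact k / ((real (t + k) + 2) * F) * (b - a)" for a b :: real
    proof -
      have "fact t * fact k / F * a =
          (real (t + k) + 2) * (fact t * fact k) / ((real (t + k) + 2) * F) * a"
        using pos by simp
      then show ?thesis
        by (simp add: algebra_simps add_divide_distrib diff_divide_distrib)
    qed
    from this[of "v (insert i T) - v T" "v (insert i (insert j T)) - v (insert j T)"]
    show "fact (card T) * fact (card N - card T - 1) / fact (card N) * (v (insert i T) - v T) +
      fact (card (insert j T)) * fact (card N - card (insert j T) - 1) / fact (card N) *
        (v (insert i (insert j T)) - v (insert j T)) -
      fact (card T) * fact (card (N - {j}) - card T - 1) / fact (card (N - {j})) *
        (v (insert i T) - v T) =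
      fact (card T + 1) * fact (card N - card T - 2) / fact (card N) *
      (v (insert i (insert j T)) - v (insert i T) - v (insert j T) + v T)"
      unfolding n t_def[symmetric] e F F_def[symmetric] by (simp add: algebra_simps)
  qed
  finally show ?thesis .
qed

lemma shapley_balanced_contributions:
  assumes "finite N" "i \<in> N" "j \<in> N"
  shows "shapley N v i - shapley (N - {j}) v i = shapley N v j - shapley (N - {i}) v j"
proof (cases "i = j")
  case False
  then show ?thesis
    using shapley_contribution[OF assms(1,2,3) False, of v]
      shapley_contribution[OF assms(1,3,2) False[symmetric], of v]
    by (simp add: insert_commute algebra_simps)
qed simp

section \<open>The characterization\<close>

lemma MPW_apply:
  assumes "N \<subseteq> U" "w \<in> tux_games N"
  shows "MPW U N w = shapley N (average_game N w)"
  using assms by (simp add: MPW_def)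

lemma MPW_efficient:
  assumes "finite U"
  shows "efficient U (MPW U)"
  unfolding efficient_def
  using finite_subset[OF _ assms]
  by (simp add: MPW_apply shapley_efficient average_game_grand average_game_empty)

text \<open>Expresses the reduced payoffs through the one game \<open>average_game N w\<close>, to
  which the Shapley identity applies. The two average games agree only on subsets of
  \<open>N - {j}\<close>, which suffices by \<open>shapley_cong\<close>.\<close>

lemma MPW_remove_player:
  assumes "finite U" "N \<subseteq> U" "w \<in> tux_games N" "j \<in> N"
  shows "MPW U (N - {j}) (remove_player N w j) = shapley (N - {j}) (average_game N w)"
proof -
  have "MPW U (N - {j}) (remove_player N w j) =
      shapley (N - {j}) (average_game (N - {j}) (remove_player N w j))"
    using assms remove_player_tux_game by (intro MPW_apply) auto
  also have "\<dots> = shapley (N - {j}) (average_game N w)"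
    using assms finite_subset[OF assms(2,1)] by (intro shapley_cong average_game_remove_player) auto
  finally show ?thesis .
qed

lemma MPW_balanced_contributions:
  assumes "finite U"
  shows "balanced_contributions U (MPW U)"
  unfolding balanced_contributions_def
  using assms finite_subset[OF _ assms]
  by (simp add: MPW_apply MPW_remove_player shapley_balanced_contributions)

section \<open>Uniqueness\<close>

lemma efficient_balanced_unique:
  assumes "finite U"
    and \<phi>: "\<phi> \<in> tux_solutions U" "efficient U \<phi>" "balanced_contributions U \<phi>"
    and \<psi>: "\<psi> \<in> tux_solutions U" "efficient U \<psi>" "balanced_contributions U \<psi>"
  shows "\<phi> = \<psi>"
proof -
  have eq: "\<phi> N w i = \<psi> N w i" if "N \<subseteq> U" "w \<in> tux_games N" "i \<in> N" for N w i
    using finite_subset[OF that(1) assms(1)] that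
  proof (induction N arbitrary: w i rule: finite_psubset_induct)
    case (psubset N)
    have same: "\<phi> N w j - \<psi> N w j = \<phi> N w i - \<psi> N w i" if j: "j \<in> N" for j
    proof (cases "j = i")
      case False
      \<comment> \<open>Both reduced games have smaller player sets, so these payoffs cancel when
        the two balance equations are subtracted.\<close>
      have "\<phi> (N - {j}) (remove_player N w j) i = \<psi> (N - {j}) (remove_player N w j) i"
        "\<phi> (N - {i}) (remove_player N w i) j = \<psi> (N - {i}) (remove_player N w i) j"
        using psubset.prems j False
        by (intro psubset.IH remove_player_tux_game; auto)+
      moreover have "\<phi> N w i - \<phi> (N - {j}) (remove_player N w j) i =
          \<phi> N w j - \<phi> (N - {i}) (remove_player N w i) j"
        "\<psi> N w i - \<psi> (N - {j}) (remove_player N w j) i =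
          \<psi> N w j - \<psi> (N - {i}) (remove_player N w i) j"
        using \<phi>(3) \<psi>(3) psubset.prems j unfolding balanced_contributions_def by blast+
      ultimately show ?thesis by linarith
    qed simp
    have "(\<Sum>j\<in>N. \<phi> N w j - \<psi> N w j) = 0"
      using \<phi>(2) \<psi>(2) psubset.prems unfolding efficient_def by (simp add: sum_subtractf)
    moreover have "(\<Sum>j\<in>N. \<phi> N w j - \<psi> N w j) = (\<Sum>j\<in>N. \<phi> N w i - \<psi> N w i)"
      using same by (rule sum.cong[OF refl])
    ultimately have "real (card N) * (\<phi> N w i - \<psi> N w i) = 0" by simp
    moreover have "card N \<noteq> 0" using psubset.hyps psubset.prems by auto
    ultimately show ?case by simp
  qed
  \<comment> \<open>Agreement of payoffs lifts to equality of solutions by extensionality in the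
    player set, the game and the player, since each of these function spaces is a
    \<open>PiE\<close>.\<close>
  show ?thesis
  proof (rule PiE_ext[OF \<phi>(1)[unfolded tux_solutions_def] \<psi>(1)[unfolded tux_solutions_def]])
    fix N assume N: "N \<in> Pow U"
    have mem: "\<phi> N \<in> tux_games N \<rightarrow>\<^sub>E (N \<rightarrow>\<^sub>E UNIV)" "\<psi> N \<in> tux_games N \<rightarrow>\<^sub>E (N \<rightarrow>\<^sub>E UNIV)"
      using PiE_mem[OF \<phi>(1)[unfolded tux_solutions_def] N]
        PiE_mem[OF \<psi>(1)[unfolded tux_solutions_def] N] .
    show "\<phi> N = \<psi> N"
    proof (rule PiE_ext[OF mem])
      fix w assume w: "w \<in> tux_games N"
      show "\<phi> N w = \<psi> N w"
        by (rule PiE_ext[OF PiE_mem[OF mem(1) w] PiE_mem[OF mem(2) w]]) (use eq N w in auto)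
    qed
  qed
qed

theorem theorem4:
  fixes U :: "'a set"
  assumes "finite U"
  shows "MPW U \<in> tux_solutions U \<and> efficient U (MPW U) \<and> balanced_contributions U (MPW U) \<and>
    (\<forall>\<phi>\<in>tux_solutions U. efficient U \<phi> \<and> balanced_contributions U \<phi> \<longrightarrow> \<phi> = MPW U)"
  using MPW_tux_solution MPW_efficient[OF assms] MPW_balanced_contributions[OF assms]
    efficient_balanced_unique[OF assms] by blast

end
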